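(* Maximizing Nash social welfare under two-sided cardinality constraints need not give an $EF1$ allocation. That is, there exist re-sellers $U=\{u_1,\dots,u_m\}$, products $P=\{p_1,\dots,p_n\}$, nonnegative utilities $(W_{i,j})_{i\in[m],\,j\in[n]}$, integers $L_1\le L_2$, $R_1\le R_2$, and a feasible allocation $A=(A_1,\dots,A_m)$ that maximizes $$\prod_{i\in[m]}\ \sum_{p_j\in A_i}W_{i,j}$$ among all feasible allocations, such that $A$ does not satisfy $EF1$.
   Context: An instance consists of re-sellers $U=\{u_1,\dots,u_m\}$, products $P=\{p_1,\dots,p_n\}$, utilities $W_{i,j}\ge 0$ (the expected revenue of re-seller $u_i$ from product $p_j$), and nonnegative integers $L_1\le L_2$, $R_1\le R_2$. An allocation is a tuple $A=(A_1,\dots,A_m)$ of subsets $A_i\subseteq P$ (equivalently a binary $m\times n$ matrix); a product may be given to several re-sellers, but each re-seller gets at most one copy of it. The allocation is feasible if it satisfies both the re-seller constraint $L_1\le |A_i|\le L_2$ for every $i\in[m]$, and the product constraint $R_1\le |\{i\in[m] : p_j\in A_i\}|\le R_2$ for every $j\in[n]$. Utilities are additive: $U_i(S)=\sum_{p_j\in S}W_{i,j}$ for $S\subseteq P$. An allocation $A$ satisfies $EF1$ (envy-freeness up to one item) if for every pair of re-sellers $u_i,u_k$ with $A_k\neq\emptyset$ there exists $p_j\in A_k$ such that $U_i(A_i)\ge U_i(A_k\setminus\{p_j\})$. *)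

theory Defs
  imports Complex_Main "HOL-Library.FuncSet"
begin

text \<open>
  Re-sellers are the indices \<open>{1..m}\<close>, products the indices \<open>{1..n}\<close>. An allocation is an
  \<open>m\<close>-tuple of sets of products, encoded as an extensional function on \<open>{1..m}\<close>, so that two
  allocations are equal iff they agree as tuples.
\<close>

definition allocations :: "nat \<Rightarrow> nat \<Rightarrow> (nat \<Rightarrow> nat set) set" where
  "allocations m n = {1..m} \<rightarrow>\<^sub>E Pow {1..n}"

definition feasible ::
  "nat \<Rightarrow> nat \<Rightarrow> nat \<Rightarrow> nat \<Rightarrow> nat \<Rightarrow> nat \<Rightarrow> (nat \<Rightarrow> nat set) \<Rightarrow> bool" where
  "feasible m n L1 L2 R1 R2 A \<longleftrightarrow>
     A \<in> allocations m n \<and>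
     (\<forall>i\<in>{1..m}. L1 \<le> card (A i) \<and> card (A i) \<le> L2) \<and>
     (\<forall>j\<in>{1..n}. R1 \<le> card {i\<in>{1..m}. j \<in> A i} \<and> card {i\<in>{1..m}. j \<in> A i} \<le> R2)"

definition utility :: "(nat \<Rightarrow> nat \<Rightarrow> real) \<Rightarrow> nat \<Rightarrow> nat set \<Rightarrow> real" where
  "utility W i S = (\<Sum>j\<in>S. W i j)"

definition nash_welfare :: "nat \<Rightarrow> (nat \<Rightarrow> nat \<Rightarrow> real) \<Rightarrow> (nat \<Rightarrow> nat set) \<Rightarrow> real" where
  "nash_welfare m W A = (\<Prod>i\<in>{1..m}. utility W i (A i))"

definition EF1 :: "nat \<Rightarrow> (nat \<Rightarrow> nat \<Rightarrow> real) \<Rightarrow> (nat \<Rightarrow> nat set) \<Rightarrow> bool" where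
  "EF1 m W A \<longleftrightarrow>
     (\<forall>i\<in>{1..m}. \<forall>k\<in>{1..m}. A k \<noteq> {} \<longrightarrow>
        (\<exists>j\<in>A k. utility W i (A i) \<ge> utility W i (A k - {j})))"

end

theory Submission
  imports Defs
begin

text \<open>
  Two re-sellers split four products evenly, each product being sold once. Re-seller 1 values the
  products at 2, 2, 5, 5 and re-seller 2 at 0, 0, 1, 1. If re-seller 2 gets \<open>k\<close> of the products 3
  and 4, the welfare is \<open>(10 - 3 * k) * k\<close>, which for \<open>k \<le> 2\<close> is largest at \<open>k = 2\<close>. There
  re-seller 1 has utility 4, but either one of the other re-seller's products is worth 5 to him.
\<close>

text \<open>Padding the sum with zero terms outside \<open>S\<close> leaves four membership bits as
  the only unknowns, so welfare and cardinality become finite case checks.\<close>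

lemma sum_subset_1_4:
  fixes f :: "nat \<Rightarrow> 'a::semiring_1"
  assumes "S \<subseteq> {1..4}"
  shows "sum f S = of_bool (1 \<in> S) * f 1 + of_bool (2 \<in> S) * f 2
                 + of_bool (3 \<in> S) * f 3 + of_bool (4 \<in> S) * f 4"
proof -
  have "sum f S = (\<Sum>j\<in>{1..4}. of_bool (j \<in> S) * f j)"
    using assms by (intro sum.mono_neutral_cong_left) auto
  also have "{1..4::nat} = {1, 2, 3, 4}" by auto
  finally show ?thesis by (simp add: add.assoc)
qed

lemma card_subset_1_4:
  assumes "S \<subseteq> {1..4::nat}"
  shows "card S = of_bool (1 \<in> S) + of_bool (2 \<in> S) + of_bool (3 \<in> S) + of_bool (4 \<in> S)"
  using sum_subset_1_4[OF assms, of "\<lambda>_. 1::nat"] by simp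

lemma card_owners_two:
  "card {i\<in>{1..2::nat}. j \<in> A i} = of_bool (j \<in> A 1) + of_bool (j \<in> A 2)"
proof -
  have "{i\<in>{1..2::nat}. j \<in> A i} = (if j \<in> A 1 then {1} else {}) \<union> (if j \<in> A 2 then {2} else {})"
    by (auto simp: numeral_2_eq_2 le_Suc_eq)
  then show ?thesis by simp
qed

definition ex_W :: "nat \<Rightarrow> nat \<Rightarrow> real" where
  "ex_W i j = (if i = 1 then if j \<le> 2 then 2 else 5 else if j \<le> 2 then 0 else 1)"

text \<open>The bounded abstraction gives \<open>undefined\<close> outside \<open>{1..2}\<close>, as
  the extensional function space in \<open>allocations\<close> demands.\<close>

definition ex_alloc :: "nat \<Rightarrow> nat set" where
  "ex_alloc = (\<lambda>i\<in>{1..2}. if i = 1 then {1, 2} else {3, 4})"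

lemma ex_alloc_simps:
  "ex_alloc 1 = {1, 2}" "ex_alloc 2 = {3, 4}"
  by (auto simp: ex_alloc_def)

lemma atLeastAtMost_1_2: "{1..2::nat} = {1, 2}"
  by auto

lemma feasible_ex_alloc: "feasible 2 4 2 2 1 1 ex_alloc"
proof -
  have "ex_alloc \<in> allocations 2 4"
    by (auto simp: allocations_def ex_alloc_def)
  moreover have "{1..4::nat} = {1, 2, 3, 4}" by auto
  ultimately show ?thesis
    unfolding feasible_def card_owners_two by (simp add: atLeastAtMost_1_2 ex_alloc_simps del: One_nat_def)
qed

lemma nash_welfare_ex_alloc: "nash_welfare 2 ex_W ex_alloc = 8"
  by (simp add: nash_welfare_def utility_def ex_W_def ex_alloc_simps atLeastAtMost_1_2 del: One_nat_def)

lemma nash_welfare_le: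
  assumes "feasible 2 4 2 2 1 1 A"
  shows "nash_welfare 2 ex_W A \<le> 8"
proof -
  have sub: "A 1 \<subseteq> {1..4}" "A 2 \<subseteq> {1..4}"
    using assms by (auto simp: feasible_def allocations_def PiE_def Pi_def)
  have "card (A 1) = 2"
    using assms unfolding feasible_def atLeastAtMost_1_2 by force
  \<comment> \<open>The lower and upper product bounds are both 1, so \<open>A 2\<close> is the
    complement of \<open>A 1\<close>.\<close>
  moreover have "of_bool (j \<in> A 1) + of_bool (j \<in> A 2) = (1::nat)" if "j \<in> {1..4}" for j
    using assms that unfolding feasible_def card_owners_two by (metis order_antisym)
  then have "j \<in> A 2 \<longleftrightarrow> j \<notin> A 1" if "j \<in> {1..4}" for j
    using that by (cases "j \<in> A 1"; cases "j \<in> A 2") fastforce+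
  then have "1 \<in> A 2 \<longleftrightarrow> 1 \<notin> A 1" "2 \<in> A 2 \<longleftrightarrow> 2 \<notin> A 1"
    "3 \<in> A 2 \<longleftrightarrow> 3 \<notin> A 1" "4 \<in> A 2 \<longleftrightarrow> 4 \<notin> A 1"
    by simp_all
  moreover have "nash_welfare 2 ex_W A = sum (ex_W 1) (A 1) * sum (ex_W 2) (A 2)"
    by (simp add: nash_welfare_def utility_def atLeastAtMost_1_2 del: One_nat_def)
  \<comment> \<open>Only the four bits of \<open>A 1\<close> remain. The patterns of size 2 give
    welfare 8, 7 or 0, according to whether re-seller 2 holds two, one or none of the products 3 and
    4.\<close>
  ultimately show ?thesis
    unfolding card_subset_1_4[OF sub(1)] sum_subset_1_4[OF sub(1)] sum_subset_1_4[OF sub(2)]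
    by (simp add: ex_W_def of_bool_def split: if_splits)
qed

lemma not_EF1_ex_alloc: "\<not> EF1 2 ex_W ex_alloc"
proof
  assume "EF1 2 ex_W ex_alloc"
  then have "\<exists>j\<in>ex_alloc 2. utility ex_W 1 (ex_alloc 1) \<ge> utility ex_W 1 (ex_alloc 2 - {j})"
    unfolding EF1_def atLeastAtMost_1_2 by (simp add: ex_alloc_simps del: One_nat_def)
  \<comment> \<open>Both candidates for the removed product leave a singleton, and each would
    require 4 \<ge> 5.\<close>
  moreover have "{3, 4} - {3} = {4::nat}" "{3, 4} - {4} = {3::nat}" by auto
  ultimately show False
    by (auto simp: utility_def ex_W_def ex_alloc_simps simp del: One_nat_def)
qed

theorem theorem3p3:
  "\<exists>(m::nat) (n::nat) (W :: nat \<Rightarrow> nat \<Rightarrow> real) (L1::nat) (L2::nat) (R1::nat) (R2::nat)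
      (A :: nat \<Rightarrow> nat set).
     (\<forall>i\<in>{1..m}. \<forall>j\<in>{1..n}. 0 \<le> W i j) \<and>
     L1 \<le> L2 \<and> R1 \<le> R2 \<and>
     is_arg_max (nash_welfare m W) (feasible m n L1 L2 R1 R2) A \<and>
     \<not> EF1 m W A"
proof (intro exI conjI)
  show "\<forall>i\<in>{1..2}. \<forall>j\<in>{1..4}. 0 \<le> ex_W i j"
    by (simp add: ex_W_def)
  show "is_arg_max (nash_welfare 2 ex_W) (feasible 2 4 2 2 1 1) ex_alloc"
    unfolding is_arg_max_linorder nash_welfare_ex_alloc
    using feasible_ex_alloc nash_welfare_le by blast
qed (use not_EF1_ex_alloc in auto)

end
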